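(* Let $\kappa\in\mathbb N$, $\eta>0$, $K>0$, and let $PA=PA(\kappa,\eta,K)\subset L^2([-\pi,\pi])$ be the set of piecewise real analytic functions on $[-\pi,\pi]$ with at most $\kappa$ discontinuity points, such that each of their analytic pieces can be extended into a complex $\eta$-neighborhood of the corresponding real segment and is bounded there by $K$. Then $$H(\epsilon,PA)\asymp\log^2\left(\frac1\epsilon\right).$$
   Context: For a relatively compact subset $Q$ of a Hilbert space $V$ and $\epsilon>0$, $M(\epsilon,Q)$ is the minimal number of balls of radius $\epsilon$ in $V$ covering $Q$, and $H(\epsilon,Q)=\log_2M(\epsilon,Q)$ is the Kolmogorov $\epsilon$-entropy. Here $V=L^2([-\pi,\pi])$. The symbol $\asymp$ denotes equivalence, as $\epsilon\to0$, up to positive multiplicative constants not depending on $\epsilon$ (they may depend on $\kappa,\eta,K$). The "corresponding real segment" of an analytic piece is the segment between consecutive discontinuity points (or endpoints of $[-\pi,\pi]$) on which the piece is defined; extension into the complex neighborhood means holomorphic extension. *)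

theory Defs
  imports "HOL-Complex_Analysis.Complex_Analysis" "HOL-Library.Landau_Symbols"
begin

section \<open>The Hilbert space of real square-integrable functions on the interval from -pi to pi\<close>

abbreviation leb_pi :: "real measure" where
  "leb_pi \<equiv> lebesgue_on {-pi..pi}"

definition square_integrable :: "(real \<Rightarrow> real) \<Rightarrow> bool" where
  "square_integrable f \<longleftrightarrow> f \<in> borel_measurable leb_pi \<and> integrable leb_pi (\<lambda>x. (f x)\<^sup>2)"

lemma square_integrable_zero: "square_integrable (\<lambda>x. 0)"
  by (simp add: square_integrable_def)

lemma square_integrable_scale: "square_integrable f \<Longrightarrow> square_integrable (\<lambda>x. c * f x)"
  by (auto simp: square_integrable_def power_mult_distrib)

lemma square_integrable_mult:
  assumes "square_integrable f" "square_integrable g"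
  shows "integrable leb_pi (\<lambda>x. f x * g x)"
proof (rule Bochner_Integration.integrable_bound)
  show "integrable leb_pi (\<lambda>x. (f x)\<^sup>2 + (g x)\<^sup>2)"
    using assms by (simp add: square_integrable_def)
  show "(\<lambda>x. f x * g x) \<in> borel_measurable leb_pi"
    using assms by (auto simp: square_integrable_def)
  have "\<bar>a * b\<bar> \<le> a\<^sup>2 + b\<^sup>2" for a b :: real
  proof -
    have "2 * (\<bar>a\<bar> * \<bar>b\<bar>) \<le> a\<^sup>2 + b\<^sup>2"
      using sum_squares_bound[of "\<bar>a\<bar>" "\<bar>b\<bar>"] by simp
    then show ?thesis
      unfolding abs_mult using mult_nonneg_nonneg[of "\<bar>a\<bar>" "\<bar>b\<bar>"] by linarith
  qed
  then show "AE x in leb_pi. norm (f x * g x) \<le> norm ((f x)\<^sup>2 + (g x)\<^sup>2)"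
    by simp
qed

lemma square_integrable_add:
  assumes "square_integrable f" "square_integrable g"
  shows "square_integrable (\<lambda>x. f x + g x)"
  using assms square_integrable_mult[OF assms]
  by (auto simp: square_integrable_def power2_sum mult.assoc)

definition l2_rel :: "(real \<Rightarrow> real) \<Rightarrow> (real \<Rightarrow> real) \<Rightarrow> bool" where
  "l2_rel f g \<longleftrightarrow> square_integrable f \<and> square_integrable g \<and> (AE x in leb_pi. f x = g x)"

lemma part_equivp_l2_rel: "part_equivp l2_rel"
proof (rule part_equivpI)
  show "\<exists>f. l2_rel f f"
    using square_integrable_zero by (auto simp: l2_rel_def)
  show "symp l2_rel"
    by (rule sympI) (auto simp: l2_rel_def elim: AE_mp)
  show "transp l2_rel"
  proof (rule transpI)
    fix f g h assume "l2_rel f g" "l2_rel g h"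
    then show "l2_rel f h"
      unfolding l2_rel_def by (auto elim: AE_mp)
  qed
qed

quotient_type l2 = "real \<Rightarrow> real" / partial: l2_rel
  morphisms rep_l2 l2_class
  by (rule part_equivp_l2_rel)

instantiation l2 :: real_inner
begin

lift_definition zero_l2 :: l2 is "\<lambda>x. 0"
  by (simp add: l2_rel_def square_integrable_zero)

lift_definition plus_l2 :: "l2 \<Rightarrow> l2 \<Rightarrow> l2" is "\<lambda>f g x. f x + g x"
  by (auto simp: l2_rel_def square_integrable_add)

lift_definition scaleR_l2 :: "real \<Rightarrow> l2 \<Rightarrow> l2" is "\<lambda>c f x. c * f x"
  by (auto simp: l2_rel_def square_integrable_scale)

definition uminus_l2 :: "l2 \<Rightarrow> l2" where "- f = (-1) *\<^sub>R f" for f :: l2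

definition minus_l2 :: "l2 \<Rightarrow> l2 \<Rightarrow> l2" where "f - g = f + - g" for f g :: l2

lift_definition inner_l2 :: "l2 \<Rightarrow> l2 \<Rightarrow> real" is "\<lambda>f g. integral\<^sup>L leb_pi (\<lambda>x. f x * g x)"
  by (rule integral_cong_AE) (auto simp: l2_rel_def square_integrable_def)

definition norm_l2 :: "l2 \<Rightarrow> real" where "norm f = sqrt (f \<bullet> f)" for f :: l2

definition dist_l2 :: "l2 \<Rightarrow> l2 \<Rightarrow> real" where "dist f g = norm (f - g)" for f g :: l2

definition sgn_l2 :: "l2 \<Rightarrow> l2" where "sgn f = inverse (norm f) *\<^sub>R f" for f :: l2

definition uniformity_l2 :: "(l2 \<times> l2) filter" where
  "uniformity = (INF e\<in>{0<..}. principal {(f :: l2, g). dist f g < e})"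

definition open_l2 :: "l2 set \<Rightarrow> bool" where
  "open U \<longleftrightarrow> (\<forall>f\<in>U. \<forall>\<^sub>F (f', g) in uniformity. f' = f \<longrightarrow> g \<in> U)" for U :: "l2 set"

instance
proof
  fix f g h :: l2 and a b :: real
  show "f + g + h = f + (g + h)"
    by transfer (auto simp: l2_rel_def square_integrable_add add.assoc)
  show "f + g = g + f"
    by transfer (auto simp: l2_rel_def square_integrable_add add.commute)
  show "0 + f = f"
    by transfer (auto simp: l2_rel_def)
  show "- f + f = 0"
    unfolding uminus_l2_def
    by transfer (auto simp: l2_rel_def square_integrable_zero)
  show "f - g = f + - g"
    by (rule minus_l2_def)
  show "a *\<^sub>R (f + g) = a *\<^sub>R f + a *\<^sub>R g"
    by transfer
      (auto simp: l2_rel_def square_integrable_add square_integrable_scale distrib_left)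
  show "(a + b) *\<^sub>R f = a *\<^sub>R f + b *\<^sub>R f"
    by transfer (auto simp: l2_rel_def square_integrable_add square_integrable_scale
        distrib_right)
  show "a *\<^sub>R b *\<^sub>R f = (a * b) *\<^sub>R f"
    by transfer (auto simp: l2_rel_def square_integrable_scale mult.assoc)
  show "1 *\<^sub>R f = f"
    by transfer (auto simp: l2_rel_def)
  show "sgn f = inverse (norm f) *\<^sub>R f"
    by (rule sgn_l2_def)
  show "dist f g = norm (f - g)"
    by (rule dist_l2_def)
  show "norm f = sqrt (f \<bullet> f)"
    by (rule norm_l2_def)
  show "f \<bullet> g = g \<bullet> f"
    by transfer (simp add: mult.commute)
  show "(f + g) \<bullet> h = f \<bullet> h + g \<bullet> h"
    by transfer
      (simp add: l2_rel_def distrib_right square_integrable_mult)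
  show "(a *\<^sub>R f) \<bullet> g = a * (f \<bullet> g)"
    by transfer (simp add: mult.assoc)
  show "0 \<le> f \<bullet> f"
    by transfer simp
  show "f \<bullet> f = 0 \<longleftrightarrow> f = 0"
  proof transfer
    fix f assume "l2_rel f f"
    then have f: "square_integrable f" by (simp add: l2_rel_def)
    then have "integral\<^sup>L leb_pi (\<lambda>x. (f x)\<^sup>2) = 0 \<longleftrightarrow> (AE x in leb_pi. (f x)\<^sup>2 = 0)"
      by (intro integral_nonneg_eq_0_iff_AE) (auto simp: square_integrable_def)
    with f show "integral\<^sup>L leb_pi (\<lambda>x. f x * f x) = 0 \<longleftrightarrow> l2_rel f (\<lambda>x. 0)"
      by (simp add: l2_rel_def square_integrable_zero power2_eq_square)
  qed
qed (rule uniformity_l2_def open_l2_def)+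

end


section \<open>Kolmogorov entropy\<close>

text \<open>
  \<open>Inf\<close> of the empty set of natural numbers is 0, so the definitions below return 0 when \<open>Q\<close> has no
  finite cover; they are meaningful for totally bounded \<open>Q\<close>.
\<close>

definition covering_number :: "real \<Rightarrow> 'a::metric_space set \<Rightarrow> nat" where
  "covering_number \<epsilon> Q = (INF C\<in>{C. finite C \<and> Q \<subseteq> (\<Union>c\<in>C. ball c \<epsilon>)}. card C)"

definition kolmogorov_entropy :: "real \<Rightarrow> 'a::metric_space set \<Rightarrow> real" where
  "kolmogorov_entropy \<epsilon> Q = log 2 (real (covering_number \<epsilon> Q))"


section \<open>Piecewise analytic functions\<close>

definition discontinuity_points :: "(real \<Rightarrow> real) \<Rightarrow> real set" where
  "discontinuity_points f = {x \<in> {-pi..pi}. \<not> continuous (at x within {-pi..pi}) f}"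

definition complex_nbhd :: "real \<Rightarrow> real \<Rightarrow> real \<Rightarrow> complex set" where
  "complex_nbhd \<eta> a b = (\<Union>x\<in>{a..b}. ball (complex_of_real x) \<eta>)"

definition extends_bounded :: "real \<Rightarrow> real \<Rightarrow> (real \<Rightarrow> real) \<Rightarrow> real \<Rightarrow> real \<Rightarrow> bool" where
  "extends_bounded \<eta> K f a b \<longleftrightarrow>
     (\<exists>F. F holomorphic_on complex_nbhd \<eta> a b \<and>
          (\<forall>x\<in>{a<..<b}. F (complex_of_real x) = complex_of_real (f x)) \<and>
          (\<forall>z\<in>complex_nbhd \<eta> a b. norm (F z) \<le> K))"

text \<open>
  The pieces live on the open segments between consecutive elements of the set of discontinuity
  points together with the two endpoints.  Real analyticity of each piece, up to the ends of its
  segment, is part of the existence of the holomorphic extension.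

  The discontinuity points are those of the pointwise function.  Since values at finitely many
  points do not affect the class in \<open>l2\<close>, a representative can be made discontinuous at any point
  where two pieces meet, so a class such as that of the absolute value is covered as one with a
  single breakpoint.
\<close>

definition piecewise_analytic :: "nat \<Rightarrow> real \<Rightarrow> real \<Rightarrow> (real \<Rightarrow> real) \<Rightarrow> bool" where
  "piecewise_analytic \<kappa> \<eta> K f \<longleftrightarrow>
     finite (discontinuity_points f) \<and> card (discontinuity_points f) \<le> \<kappa> \<and>
     (\<forall>a \<in> discontinuity_points f \<union> {-pi, pi}. \<forall>b \<in> discontinuity_points f \<union> {-pi, pi}.
        a < b \<and> {a<..<b} \<inter> discontinuity_points f = {} \<longrightarrow> extends_bounded \<eta> K f a b)"

definition PA :: "nat \<Rightarrow> real \<Rightarrow> real \<Rightarrow> l2 set" where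
  "PA \<kappa> \<eta> K = {l2_class f | f. square_integrable f \<and> piecewise_analytic \<kappa> \<eta> K f}"

end

theory Submission
  imports Defs "HOL-Real_Asymp.Real_Asymp"
begin

text \<open>
  Upper bound: partition the interval into a fixed number of cells of width \<open>\<eta>/4\<close>. On each cell, each
  of the at most \<open>\<kappa> + 1\<close> analytic pieces meeting it is determined up to \<open>\<epsilon>\<close> by \<open>O(log (1/\<epsilon>))\<close> Taylor
  coefficients at the cell's left end, each known to precision of order \<open>\<epsilon>\<close>; this costs
  \<open>O(log (1/\<epsilon>)\<^sup>2)\<close> bits. The discontinuities are only located up to precision of order \<open>\<epsilon>\<^sup>2\<close>, which
  costs \<open>O(log (1/\<epsilon>))\<close> bits and affects the functions on a set of measure \<open>O(\<epsilon>\<^sup>2)\<close>, where they are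
  bounded.

  Lower bound: the sums of \<open>2 \<epsilon> t\<^sub>k cos (k x)\<close> over \<open>1 \<le> k \<le> n\<close> with integers \<open>0 \<le> t\<^sub>k < m\<close> are
  \<open>2 \<epsilon>\<close>-separated by orthogonality, and they belong to the class, without discontinuities, when \<open>n\<close> is
  a small multiple of \<open>log (1/\<epsilon>)\<close> and \<open>m\<close> is about \<open>\<epsilon>\<close> to the power \<open>-1/4\<close>. There are \<open>m\<close> to the
  power \<open>n\<close> of them.
\<close>

section \<open>Covering numbers\<close>

lemma covering_number_le:
  assumes "finite C" "Q \<subseteq> (\<Union>c\<in>C. ball c \<epsilon>)"
  shows "covering_number \<epsilon> Q \<le> card C"
  unfolding covering_number_def using assms by (intro cINF_lower) auto

text \<open>One representative is chosen for each code value, and its image serves as the centre for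
  everything with that code. This bounds covers by counting codes, without constructing approximants
  as elements of the space. A value in \<open>T\<close> that is never attained only adds an
  arbitrary, harmless centre.\<close>

lemma finite_code_cover:
  fixes cls :: "'a \<Rightarrow> 'b::metric_space" and code :: "'a \<Rightarrow> 'c"
  assumes "finite T"
    and "\<And>f. P f \<Longrightarrow> code f \<in> T"
    and "\<And>f g. P f \<Longrightarrow> P g \<Longrightarrow> code f = code g \<Longrightarrow> dist (cls f) (cls g) < \<epsilon>"
  obtains C where "finite C" "card C \<le> card T" "{cls f | f. P f} \<subseteq> (\<Union>c\<in>C. ball c \<epsilon>)"
proof
  let ?rep = "\<lambda>t. SOME f. P f \<and> code f = t"
  let ?C = "(\<lambda>t. cls (?rep t)) ` T"
  show "finite ?C" "card ?C \<le> card T"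
    using assms(1) by (auto intro: card_image_le)
  show "{cls f | f. P f} \<subseteq> (\<Union>c\<in>?C. ball c \<epsilon>)"
  proof safe
    fix f assume f: "P f"
    then have "P (?rep (code f)) \<and> code (?rep (code f)) = code f"
      by (intro someI[of "\<lambda>g. P g \<and> code g = code f" f]) auto
    then have "dist (cls (?rep (code f))) (cls f) < \<epsilon>"
      using assms(3) f by blast
    then show "cls f \<in> (\<Union>c\<in>?C. ball c \<epsilon>)"
      using assms(2)[OF f] by auto
  qed
qed

text \<open>An open ball of radius \<epsilon> contains at most one of several points at mutual
  distance at least 2 \<epsilon>, so assigning to each point a centre near it is injective. The
  cover \<open>C0\<close> keeps the infimum from ranging over the empty set.\<close>

lemma separated_le_covering_number:
  fixes x :: "'i \<Rightarrow> 'a::metric_space"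
  assumes "finite C0" "Q \<subseteq> (\<Union>c\<in>C0. ball c \<epsilon>)"
    and Q: "\<And>t. t \<in> T \<Longrightarrow> x t \<in> Q"
    and sep: "\<And>s t. s \<in> T \<Longrightarrow> t \<in> T \<Longrightarrow> s \<noteq> t \<Longrightarrow> 2 * \<epsilon> \<le> dist (x s) (x t)"
  shows "card T \<le> covering_number \<epsilon> Q"
  unfolding covering_number_def
proof (rule cINF_greatest)
  show "{C. finite C \<and> Q \<subseteq> (\<Union>c\<in>C. ball c \<epsilon>)} \<noteq> {}"
    using assms(1,2) by auto
next
  fix C assume "C \<in> {C. finite C \<and> Q \<subseteq> (\<Union>c\<in>C. ball c \<epsilon>)}"
  then have C: "finite C" "Q \<subseteq> (\<Union>c\<in>C. ball c \<epsilon>)" by auto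
  have "\<forall>t\<in>T. \<exists>c\<in>C. dist c (x t) < \<epsilon>"
    using C(2) Q by fastforce
  then obtain c where c: "\<And>t. t \<in> T \<Longrightarrow> c t \<in> C \<and> dist (c t) (x t) < \<epsilon>"
    by metis
  have "inj_on c T"
  proof (rule inj_onI, rule ccontr)
    fix s t assume st: "s \<in> T" "t \<in> T" "c s = c t" "s \<noteq> t"
    have "dist (x s) (x t) \<le> dist (c s) (x s) + dist (c s) (x t)"
      by (metis dist_commute dist_triangle)
    with c[of s] c[of t] sep[of s t] st show False by auto
  qed
  then show "card T \<le> card C"
    using c C(1) by (intro card_inj_on_le[of c]) auto
qed

lemma dist_l2_class:
  assumes f: "square_integrable f" and g: "square_integrable g"
  shows "(dist (l2_class f) (l2_class g))\<^sup>2 = integral\<^sup>L leb_pi (\<lambda>x. (f x - g x)\<^sup>2)"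
proof -
  have rel: "l2_rel h h" if "square_integrable h" for h
    using that by (simp add: l2_rel_def)
  have g': "square_integrable (\<lambda>x. -1 * g x)"
    by (rule square_integrable_scale[OF g])
  have s: "square_integrable (\<lambda>x. f x + -1 * g x)"
    by (rule square_integrable_add[OF f g'])
  have "l2_class f - l2_class g = l2_class (\<lambda>x. f x + -1 * g x)"
    unfolding minus_l2_def uminus_l2_def scaleR_l2.abs_eq[OF rel[OF g]]
    by (rule plus_l2.abs_eq[OF rel[OF f] rel[OF g']])
  then have "(dist (l2_class f) (l2_class g))\<^sup>2 =
      l2_class (\<lambda>x. f x + -1 * g x) \<bullet> l2_class (\<lambda>x. f x + -1 * g x)"
    by (simp only: dist_norm power2_norm_eq_inner)
  then show ?thesis
    by (simp add: inner_l2.abs_eq[OF rel[OF s] rel[OF s], simplified] power2_eq_square)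
qed

section \<open>Covers of the class of piecewise analytic functions\<close>

text \<open>Cauchy's inequality on the circle of radius \<rho> bounds the k-th Taylor coefficient by
  K / \<rho>^k. Rescaling the variable to (x - c) / \<rho> therefore bounds all coefficients by K,
  and halving the radius makes the tail geometric. At real points the real part of the series is a
  series in the real parts of its coefficients, so real \<open>a\<close> suffices.\<close>

lemma taylor_coefficients:
  assumes F: "F holomorphic_on ball (of_real c) R" and \<rho>: "0 < \<rho>" "\<rho> < R"
    and K: "\<And>z. z \<in> ball (of_real c) R \<Longrightarrow> norm (F z) \<le> K"
  obtains a :: "nat \<Rightarrow> real" where "\<And>k. \<bar>a k\<bar> \<le> K"
    and "\<And>x n. \<bar>x - c\<bar> \<le> \<rho> / 2 \<Longrightarrow>
      \<bar>Re (F (of_real x)) - (\<Sum>k<n. a k * ((x - c) / \<rho>) ^ k)\<bar> \<le> 2 * K * (1/2) ^ n"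
proof
  let ?d = "\<lambda>k. (deriv ^^ k) F (of_real c) / fact k"
  define a where "a k = Re (?d k) * \<rho> ^ k" for k
  have "norm ((deriv ^^ k) F (of_real c)) \<le> fact k * K / \<rho> ^ k" for k
  proof (rule Cauchy_inequality)
    show "F holomorphic_on ball (of_real c) \<rho>"
      using \<rho> by (intro holomorphic_on_subset[OF F]) auto
    have "cball (of_real c) \<rho> \<subseteq> ball (complex_of_real c) R"
      using \<rho> by auto
    then show "continuous_on (cball (of_real c) \<rho>) F"
      using holomorphic_on_imp_continuous_on[OF F] continuous_on_subset by blast
    show "norm (F z) \<le> K" if "norm (of_real c - z) = \<rho>" for z
      using that \<rho> by (intro K) (simp add: dist_norm)
  qed (use \<rho> in auto)
  then have "norm (?d k) * \<rho> ^ k \<le> K" for k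
    using \<rho> by (simp add: norm_divide field_simps)
  moreover have "\<bar>a k\<bar> \<le> norm (?d k) * \<rho> ^ k" for k
    unfolding a_def using \<rho> abs_Re_le_cmod[of "?d k"] by (simp add: abs_mult)
  ultimately show ak: "\<bar>a k\<bar> \<le> K" for k
    using order_trans by blast
  fix x n assume x: "\<bar>x - c\<bar> \<le> \<rho> / 2"
  define t where "t = (x - c) / \<rho>"
  have t: "\<bar>t\<bar> \<le> 1/2"
    using x \<rho> by (simp add: t_def field_simps)
  have "of_real x \<in> ball (complex_of_real c) R"
    using x \<rho> by (auto simp: dist_real_def abs_minus_commute)
  then have "(\<lambda>k. ?d k * (of_real x - of_real c) ^ k) sums F (of_real x)"
    by (rule holomorphic_power_series[OF F])
  then have "(\<lambda>k. Re (?d k * (of_real x - of_real c) ^ k)) sums Re (F (of_real x))"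
    by (rule sums_Re)
  moreover have "Re (?d k * (of_real x - of_real c) ^ k) = a k * t ^ k" for k
  proof -
    have "(of_real x - of_real c) ^ k = complex_of_real ((x - c) ^ k)"
      by simp
    moreover have "Re (z * complex_of_real y) = Re z * y" for z y
      by simp
    ultimately show ?thesis
      using \<rho> by (simp only: a_def t_def power_divide) simp
  qed
  ultimately have s: "(\<lambda>k. a k * t ^ k) sums Re (F (of_real x))"
    by simp
  have bnd: "norm (a (k + n) * t ^ (k + n)) \<le> K * (1/2) ^ n * (1/2) ^ k" for k
  proof -
    have "norm (a (k + n) * t ^ (k + n)) = \<bar>a (k + n)\<bar> * \<bar>t\<bar> ^ (k + n)"
      by (simp add: abs_mult power_abs)
    also have "\<dots> \<le> K * (1/2) ^ (k + n)"
      using ak[of "k + n"] t by (intro mult_mono power_mono) auto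
    finally show ?thesis by (simp add: power_add mult_ac)
  qed
  have g: "(\<lambda>k. K * (1/2) ^ n * (1/2) ^ k) sums (K * (1/2) ^ n * 2)"
    using sums_mult[OF geometric_sums[of "1/2::real"], of "K * (1/2) ^ n"] by simp
  have "norm (\<Sum>k. a (k + n) * t ^ (k + n)) \<le> (\<Sum>k. K * (1/2) ^ n * (1/2) ^ k)"
    by (rule norm_suminf_le[OF bnd sums_summable[OF g]])
  also have "\<dots> = 2 * K * (1/2) ^ n"
    using sums_unique[OF g] by simp
  also have "(\<Sum>k. a (k + n) * t ^ (k + n)) = Re (F (of_real x)) - (\<Sum>k<n. a k * t ^ k)"
    using suminf_minus_initial_segment[OF sums_summable[OF s]] sums_unique[OF s] by metis
  finally show "\<bar>Re (F (of_real x)) - (\<Sum>k<n. a k * ((x - c) / \<rho>) ^ k)\<bar> \<le> 2 * K * (1/2) ^ n"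
    by (simp add: t_def)
qed

text \<open>The piece is bounded by the neighbours of \<open>x\<close> among the discontinuities and
  the points -pi and pi. The last clause lets one extension serve every point reachable from
  \<open>x\<close> without crossing a discontinuity: an end of the piece between \<open>x\<close>
  and \<open>y\<close> cannot be -pi or pi, as both points are interior, so it would be a
  discontinuity.\<close>

lemma piece_containing:
  assumes f: "piecewise_analytic \<kappa> \<eta> K f"
    and x: "x \<in> {-pi<..<pi}" "x \<notin> discontinuity_points f"
  obtains a b where "a < x" "x < b" "extends_bounded \<eta> K f a b"
    and "\<And>y. y \<in> {-pi<..<pi} \<Longrightarrow> {min x y..max x y} \<inter> discontinuity_points f = {} \<Longrightarrow> a < y \<and> y < b"
proof -
  let ?D = "discontinuity_points f"
  let ?E = "?D \<union> {-pi, pi}"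
  have E: "finite ?E"
    using f by (simp add: piecewise_analytic_def)
  define a where "a = Max {e\<in>?E. e < x}"
  define b where "b = Min {e\<in>?E. x < e}"
  have "a \<in> {e\<in>?E. e < x}"
    unfolding a_def using E x by (intro Max_in) auto
  then have a: "a \<in> ?E" "a < x" by auto
  have "b \<in> {e\<in>?E. x < e}"
    unfolding b_def using E x by (intro Min_in) auto
  then have b: "b \<in> ?E" "x < b" by auto
  have lea: "e \<le> a" if "e \<in> ?E" "e < x" for e
    unfolding a_def using E that by (intro Max_ge) auto
  have leb: "b \<le> e" if "e \<in> ?E" "x < e" for e
    unfolding b_def using E that by (intro Min_le) auto
  have "{a<..<b} \<inter> ?D = {}"
    using lea leb x by (metis (no_types, lifting) Un_iff disjoint_iff greaterThanLessThan_iff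
        linorder_neqE_linordered_idom not_le)
  then have "extends_bounded \<eta> K f a b"
    using f a b unfolding piecewise_analytic_def by (meson less_trans)
  moreover have "a < y \<and> y < b"
    if y: "y \<in> {-pi<..<pi}" "{min x y..max x y} \<inter> ?D = {}" for y
  proof -
    have no: "d \<notin> ?D" if "min x y \<le> d" "d \<le> max x y" for d
      using y(2) that by auto
    have "a < y"
    proof (rule ccontr)
      assume "\<not> a < y"
      moreover have "a \<in> ?D"
        using a x y(1) \<open>\<not> a < y\<close> by auto
      ultimately show False
        using no[of a] a by auto
    qed
    moreover have "y < b"
    proof (rule ccontr)
      assume "\<not> y < b"
      moreover have "b \<in> ?D"
        using b x y(1) \<open>\<not> y < b\<close> by auto
      ultimately show False
        using no[of b] b by auto
    qed
    ultimately show ?thesis by simp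
  qed
  ultimately show ?thesis using that a b by blast
qed

text \<open>This crude bound controls the functions on the grid cells hit by discontinuities, where
  no Taylor approximation is available. It holds because a real point of a piece lies in the
  neighbourhood where the extension is bounded.\<close>

lemma bounded_off_discontinuities:
  assumes f: "piecewise_analytic \<kappa> \<eta> K f" and "\<eta> > 0"
    and x: "x \<in> {-pi<..<pi}" "x \<notin> discontinuity_points f"
  shows "\<bar>f x\<bar> \<le> K"
proof -
  obtain a b where ab: "a < x" "x < b" "extends_bounded \<eta> K f a b"
    using piece_containing[OF f x] by blast
  then obtain F where F: "\<forall>x\<in>{a<..<b}. F (of_real x) = complex_of_real (f x)"
    "\<forall>z\<in>complex_nbhd \<eta> a b. norm (F z) \<le> K"
    unfolding extends_bounded_def by blast
  have "complex_of_real x \<in> complex_nbhd \<eta> a b"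
    using ab \<open>\<eta> > 0\<close> unfolding complex_nbhd_def by (intro UN_I[of x]) auto
  then show ?thesis
    using F ab by fastforce
qed

text \<open>A point is indexed by its coarse cell \<open>j\<close> of width \<eta>/4 and by the
  number \<open>r\<close> of hit fine cells to its left. Using this rank instead of the exact
  breakpoints makes the index depend on \<open>f\<close> only through \<open>S\<close>. The points
  with a given index form a run, and one Taylor expansion serves the whole run.\<close>

lemma run_approximation:
  fixes w :: real
  assumes f: "piecewise_analytic \<kappa> \<eta> K f" and pos: "\<eta> > 0" "K > 0" "w > 0"
  defines "S \<equiv> (\<lambda>d. \<lfloor>d / w\<rfloor>) ` discontinuity_points f"
  shows "\<exists>A :: int \<Rightarrow> nat \<Rightarrow> nat \<Rightarrow> real. (\<forall>j r k. \<bar>A j r k\<bar> \<le> K) \<and>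
    (\<forall>x n. x \<in> {-pi<..<pi} \<longrightarrow> \<lfloor>x / w\<rfloor> \<notin> S \<longrightarrow>
      \<bar>f x - (\<Sum>k<n. A \<lfloor>x / (\<eta>/4)\<rfloor> (card {s\<in>S. s < \<lfloor>x / w\<rfloor>}) k *
        ((x - of_int \<lfloor>x / (\<eta>/4)\<rfloor> * (\<eta>/4)) / (\<eta>/2)) ^ k)\<bar> \<le> 2 * K * (1/2) ^ n)"
proof -
  let ?D = "discontinuity_points f"
  define run where "run j r x \<longleftrightarrow> x \<in> {-pi<..<pi} \<and> \<lfloor>x / w\<rfloor> \<notin> S \<and> \<lfloor>x / (\<eta>/4)\<rfloor> = j \<and>
      card {s\<in>S. s < \<lfloor>x / w\<rfloor>} = r" for j r x
  have "finite S"
    using f by (simp add: S_def piecewise_analytic_def)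
  \<comment> \<open>A discontinuity between two points would separate their runs, so a run lies in one piece.\<close>
  have no_disc: "{p..q} \<inter> ?D = {}" if "run j r p" "run j r q" for j r p q
  proof (rule ccontr)
    assume "{p..q} \<inter> ?D \<noteq> {}"
    then obtain d where d: "d \<in> ?D" "p \<le> d" "d \<le> q" by auto
    have dS: "\<lfloor>d / w\<rfloor> \<in> S"
      using d by (simp add: S_def)
    have le: "\<lfloor>p / w\<rfloor> \<le> \<lfloor>d / w\<rfloor>" "\<lfloor>d / w\<rfloor> \<le> \<lfloor>q / w\<rfloor>"
      using d pos by (auto intro!: floor_mono divide_right_mono)
    then have "\<lfloor>d / w\<rfloor> < \<lfloor>q / w\<rfloor>"
      using dS that by (auto simp: run_def order_less_le)
    then have "{s\<in>S. s < \<lfloor>p / w\<rfloor>} \<subseteq> {s\<in>S. s < \<lfloor>q / w\<rfloor>}"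
      "\<lfloor>d / w\<rfloor> \<in> {s\<in>S. s < \<lfloor>q / w\<rfloor>}" "\<lfloor>d / w\<rfloor> \<notin> {s\<in>S. s < \<lfloor>p / w\<rfloor>}"
      using le dS by auto
    then have "{s\<in>S. s < \<lfloor>p / w\<rfloor>} \<subset> {s\<in>S. s < \<lfloor>q / w\<rfloor>}"
      by blast
    then have "card {s\<in>S. s < \<lfloor>p / w\<rfloor>} < card {s\<in>S. s < \<lfloor>q / w\<rfloor>}"
      using \<open>finite S\<close> by (intro psubset_card_mono) auto
    then show False
      using that by (simp add: run_def)
  qed
  have near: "\<bar>x - of_int j * (\<eta>/4)\<bar> \<le> \<eta>/4" if "run j r x" for j r x
    using that pos floor_divide_lower[of "\<eta>/4" x] floor_divide_upper[of "\<eta>/4" x]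
    by (auto simp: run_def algebra_simps)
  have "\<exists>a. (\<forall>k. \<bar>a k\<bar> \<le> K) \<and> (\<forall>x n. run j r x \<longrightarrow>
      \<bar>f x - (\<Sum>k<n. a k * ((x - of_int j * (\<eta>/4)) / (\<eta>/2)) ^ k)\<bar> \<le> 2 * K * (1/2) ^ n)"
    for j :: int and r :: nat
  proof (cases "\<exists>x. run j r x")
    case False
    then show ?thesis
      using pos by (intro exI[of _ "\<lambda>k. 0"]) auto
  next
    case True
    then obtain x where x: "run j r x" by blast
    then have x': "x \<in> {-pi<..<pi}" "x \<notin> ?D"
      by (auto simp: run_def S_def)
    obtain a b where ab: "a < x" "x < b" "extends_bounded \<eta> K f a b"
      and piece: "\<And>y. y \<in> {-pi<..<pi} \<Longrightarrow> {min x y..max x y} \<inter> ?D = {} \<Longrightarrow> a < y \<and> y < b"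
      using piece_containing[OF f x'] by blast
    obtain F where F: "F holomorphic_on complex_nbhd \<eta> a b"
      "\<And>x. x \<in> {a<..<b} \<Longrightarrow> F (complex_of_real x) = complex_of_real (f x)"
      "\<And>z. z \<in> complex_nbhd \<eta> a b \<Longrightarrow> norm (F z) \<le> K"
      using ab unfolding extends_bounded_def by blast
    let ?c = "of_int j * (\<eta>/4)"
    \<comment> \<open>The centre \<open>?c\<close> need not lie in the piece, but it is within
      \<eta>/4 of the run point \<open>x\<close>, which leaves a disc of radius 3 \<eta>/4. The
      Taylor radius \<eta>/2 fits strictly inside it, and every run point is within half of that
      radius.\<close>
    have sub: "ball (complex_of_real ?c) (3 * \<eta> / 4) \<subseteq> complex_nbhd \<eta> a b"
    proof
      fix z assume z: "z \<in> ball (complex_of_real ?c) (3 * \<eta> / 4)"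
      have "dist (complex_of_real x) (complex_of_real ?c) = \<bar>x - ?c\<bar>"
        unfolding dist_of_real dist_real_def ..
      with z near[OF x] have "dist (complex_of_real x) z < \<eta>"
        using dist_triangle[of "complex_of_real x" z "complex_of_real ?c"]
        unfolding mem_ball by linarith
      then show "z \<in> complex_nbhd \<eta> a b"
        using ab unfolding complex_nbhd_def by (intro UN_I[of x]) auto
    qed
    obtain u :: "nat \<Rightarrow> real" where u: "\<And>k. \<bar>u k\<bar> \<le> K"
      "\<And>x n. \<bar>x - ?c\<bar> \<le> (\<eta>/2) / 2 \<Longrightarrow>
        \<bar>Re (F (of_real x)) - (\<Sum>k<n. u k * ((x - ?c) / (\<eta>/2)) ^ k)\<bar> \<le> 2 * K * (1/2) ^ n"
    proof (rule taylor_coefficients[of F ?c "3 * \<eta> / 4" "\<eta>/2" K])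
      show "F holomorphic_on ball (complex_of_real ?c) (3 * \<eta> / 4)"
        by (rule holomorphic_on_subset[OF F(1) sub])
    qed (use pos F(3) sub in auto)
    have "\<bar>f y - (\<Sum>k<n. u k * ((y - ?c) / (\<eta>/2)) ^ k)\<bar> \<le> 2 * K * (1/2) ^ n"
      if y: "run j r y" for y n
    proof -
      have "a < y \<and> y < b"
        using y x no_disc[of j r] by (intro piece) (auto simp: run_def min_def max_def)
      then have "Re (F (of_real y)) = f y"
        using F(2)[of y] by simp
      then show ?thesis
        using u(2)[of y n] near[OF y] by simp
    qed
    then show ?thesis
      using u(1) by blast
  qed
  then obtain A where "\<forall>j r. (\<forall>k. \<bar>A j r k\<bar> \<le> K) \<and> (\<forall>x n. run j r x \<longrightarrow>
      \<bar>f x - (\<Sum>k<n. A j r k * ((x - of_int j * (\<eta>/4)) / (\<eta>/2)) ^ k)\<bar> \<le> 2 * K * (1/2) ^ n)"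
    by metis
  then show ?thesis
    by (intro exI[of _ A]) (auto simp: run_def)
qed

text \<open>Off the cells in \<open>S\<close> the squared difference is at most e^2, over total
  length at most 2 pi. Each cell in \<open>S\<close> adds at most B^2 times its width. The finite
  set \<open>N\<close> holds points where even the crude bound may fail.\<close>

lemma l2_dist_le_off_cells:
  fixes w e B :: real
  assumes f: "square_integrable f" and g: "square_integrable g"
    and S: "finite (S :: int set)" "card S \<le> \<kappa>" and w: "w > 0"
    and e: "\<And>x. x \<in> {-pi<..<pi} \<Longrightarrow> \<lfloor>x / w\<rfloor> \<notin> S \<Longrightarrow> \<bar>f x - g x\<bar> \<le> e"
    and N: "finite N" and B: "\<And>x. x \<in> {-pi<..<pi} - N \<Longrightarrow> \<bar>f x - g x\<bar> \<le> B"
  shows "(dist (l2_class f) (l2_class g))\<^sup>2 \<le> 2 * pi * e\<^sup>2 + B\<^sup>2 * (real \<kappa> * w)"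
proof -
  let ?I = "\<lambda>s :: int. {of_int s * w..of_int (s + 1) * w}"
  \<comment> \<open>One majorant covers both cases. Adjacent closed cells share an endpoint, where
    the sum only gets larger.\<close>
  let ?h = "\<lambda>x. e\<^sup>2 + (\<Sum>s\<in>S. B\<^sup>2 * indicator (?I s) x)"
  have fm: "finite_measure leb_pi"
    by (rule finite_measureI) (simp add: emeasure_restrict_space space_restrict_space)
  interpret finite_measure leb_pi by (rule fm)
  have int1: "integrable leb_pi (indicator (?I s) :: real \<Rightarrow> real)" for s
  proof (rule integrable_const_bound[where B = 1])
    show "indicator (?I s) \<in> borel_measurable leb_pi"
      by (rule measurable_restrict_space1, rule borel_measurable_indicator) simp
  qed simp
  have int_h: "integrable leb_pi ?h"
    using int1 by auto
  \<comment> \<open>The pointwise bounds concern the open interval, so its two ends join the null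
    set.\<close>
  have "AE x in lebesgue. x \<notin> N \<union> {-pi, pi}"
    using N by (intro AE_not_in null_sets_completionI finite_imp_null_set_lborel) auto
  then have AE_fin: "AE x in leb_pi. x \<notin> N \<union> {-pi, pi}"
    by (subst AE_restrict_space_iff) (simp, fast elim: eventually_mono)
  have "AE x in leb_pi. x \<in> space leb_pi" by (rule AE_space)
  with AE_fin have ae: "AE x in leb_pi. (f x - g x)\<^sup>2 \<le> ?h x"
  proof eventually_elim
    fix x assume x: "x \<notin> N \<union> {-pi, pi}" "x \<in> space leb_pi"
    then have x': "x \<in> {-pi<..<pi}" by auto
    show "(f x - g x)\<^sup>2 \<le> ?h x"
    proof (cases "\<lfloor>x / w\<rfloor> \<in> S")
      case False
      then have "(f x - g x)\<^sup>2 \<le> e\<^sup>2"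
        using e[OF x'] by (metis abs_ge_zero power2_abs power_mono)
      moreover have "0 \<le> (\<Sum>s\<in>S. B\<^sup>2 * indicator (?I s) x)"
        by (intro sum_nonneg) auto
      ultimately show ?thesis by linarith
    next
      case True
      have "(f x - g x)\<^sup>2 \<le> B\<^sup>2"
        using B[of x] x x' by (metis DiffI UnI1 abs_ge_zero power2_abs power_mono)
      also have "B\<^sup>2 = B\<^sup>2 * indicator (?I \<lfloor>x / w\<rfloor>) x"
        using floor_divide_lower[OF w, of x] floor_divide_upper[OF w, of x] by auto
      also have "\<dots> \<le> (\<Sum>s\<in>S. B\<^sup>2 * indicator (?I s) x)"
        using True S by (intro member_le_sum) auto
      finally show ?thesis
        using zero_le_power2[of e] by linarith
    qed
  qed
  have int_fg: "integrable leb_pi (\<lambda>x. (f x - g x)\<^sup>2)"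
    using square_integrable_add[OF f square_integrable_scale[OF g, of "-1"]]
    by (simp add: square_integrable_def)
  have cell: "integral\<^sup>L leb_pi (indicator (?I s)) \<le> w" for s
  proof -
    have "integral\<^sup>L leb_pi (indicator (?I s)) = measure lebesgue (?I s \<inter> {-pi..pi})"
      by (simp add: measure_restrict_space space_restrict_space)
    also have "\<dots> \<le> measure lebesgue (?I s)"
      by (rule measure_mono_fmeasurable) auto
    also have "\<dots> = w"
      using w by (simp add: algebra_simps)
    finally show ?thesis .
  qed
  have "(dist (l2_class f) (l2_class g))\<^sup>2 = integral\<^sup>L leb_pi (\<lambda>x. (f x - g x)\<^sup>2)"
    by (rule dist_l2_class[OF f g])
  also have "\<dots> \<le> integral\<^sup>L leb_pi ?h"
    by (rule integral_mono_AE[OF int_fg int_h ae])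
  also have "\<dots> = 2 * pi * e\<^sup>2 + (\<Sum>s\<in>S. B\<^sup>2 * integral\<^sup>L leb_pi (indicator (?I s)))"
    using int1 by (simp add: measure_restrict_space space_restrict_space)
  also have "\<dots> \<le> 2 * pi * e\<^sup>2 + (\<Sum>s\<in>S. B\<^sup>2 * w)"
    using cell by (intro add_mono sum_mono mult_left_mono) auto
  also have "\<dots> = 2 * pi * e\<^sup>2 + B\<^sup>2 * (real (card S) * w)"
    by simp
  also have "\<dots> \<le> 2 * pi * e\<^sup>2 + B\<^sup>2 * (real \<kappa> * w)"
    using S w by (intro add_mono mult_left_mono mult_right_mono) auto
  finally show ?thesis .
qed

section \<open>Counting codes and assembling the cover\<close>

text \<open>A bound polynomial in \<open>card I\<close> is enough: with about \<epsilon>^(-2) cells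
  its logarithm is only O(log (1/\<epsilon>)). The base \<open>card I + 1\<close> is at least 1, so
  all exponents up to \<kappa> can be raised to \<kappa>.\<close>

lemma card_bounded_subsets_le:
  assumes "finite I"
  shows "card {S. S \<subseteq> I \<and> card S \<le> \<kappa>} \<le> (\<kappa> + 1) * (card I + 1) ^ \<kappa>"
proof -
  have "{S. S \<subseteq> I \<and> card S \<le> \<kappa>} = (\<Union>k\<le>\<kappa>. {S. S \<subseteq> I \<and> card S = k})"
    by auto
  also have "card \<dots> \<le> (\<Sum>k\<le>\<kappa>. card {S. S \<subseteq> I \<and> card S = k})"
    by (rule card_UN_le) simp
  also have "\<dots> \<le> (\<Sum>k\<le>\<kappa>. (card I + 1) ^ \<kappa>)"
  proof (rule sum_mono)
    fix k assume k: "k \<in> {..\<kappa>}"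
    have "(card I choose k) \<le> (card I choose k) * fact k"
      by simp
    also have "\<dots> \<le> card I ^ k"
      by (rule binomial_fact_pow)
    also have "\<dots> \<le> (card I + 1) ^ k"
      by (rule power_mono) auto
    also have "\<dots> \<le> (card I + 1) ^ \<kappa>"
      using k by (intro power_increasing) auto
    finally show "card {S. S \<subseteq> I \<and> card S = k} \<le> (card I + 1) ^ \<kappa>"
      by (simp add: n_subsets[OF assms])
  qed
  finally show ?thesis by simp
qed

lemma card_floor_interval:
  fixes y :: real
  assumes "0 \<le> y"
  shows "real (card {\<lfloor>-y\<rfloor>..\<lfloor>y\<rfloor>}) \<le> 2 * y + 2"
  using assms by simp linarith

lemma floor_eq_imp_close:
  fixes a b \<delta> :: real
  assumes "\<lfloor>a / \<delta>\<rfloor> = \<lfloor>b / \<delta>\<rfloor>" "\<delta> > 0"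
  shows "\<bar>a - b\<bar> \<le> \<delta>"
proof -
  have "\<bar>a / \<delta> - b / \<delta>\<bar> \<le> 1"
    using assms(1) by linarith
  then show ?thesis
    using assms(2) by (simp add: field_simps flip: diff_divide_distrib)
qed

text \<open>The first two factors bound the number of sets of hit fine cells. The last bounds the
  number of quantised coefficient families: one value for each coarse cell in \<open>J\<close>, each
  rank up to \<kappa> and each of the \<open>n\<close> degrees. The 4 in \<open>J\<close> is a
  convenient bound for pi.\<close>

lemma PA_cover:
  fixes \<kappa> n :: nat and \<eta> K \<epsilon> :: real
  assumes pos: "\<eta> > 0" "K > 0" "\<epsilon> > 0" and n: "64 * K * (1/2) ^ n \<le> \<epsilon>"
  defines "J \<equiv> {\<lfloor>-(4 / (\<eta>/4))\<rfloor>..\<lfloor>4 / (\<eta>/4)\<rfloor>}"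
  obtains C where "finite C" "PA \<kappa> \<eta> K \<subseteq> (\<Union>c\<in>C. ball c \<epsilon>)"
    "real (card C) \<le> (real \<kappa> + 1) * (64 * K\<^sup>2 * (real \<kappa> + 1) / \<epsilon>\<^sup>2 + 3) ^ \<kappa>
        * (32 * K / \<epsilon> + 2) ^ (card J * (\<kappa> + 1) * n)"
proof -
  define h where "h = \<eta>/4"
  \<comment> \<open>Quantisation will cost 2 \<delta> and the two truncations together \<delta>, so
    the smooth part of the squared distance is at most 8 (3 \<delta>)^2 < \<epsilon>^2 / 2. The
    width \<open>w\<close> makes the contribution (2 K)^2 \<kappa> w of the hit cells at most
    \<epsilon>^2 / 2; \<kappa> + 1 avoids dividing by zero.\<close>
  define \<delta> where "\<delta> = \<epsilon>/16"
  define w where "w = \<epsilon>\<^sup>2 / (8 * K\<^sup>2 * (real \<kappa> + 1))"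
  have w: "w > 0" and \<delta>: "\<delta> > 0" and h: "h > 0"
    using pos by (auto simp: w_def \<delta>_def h_def)
  let ?P = "\<lambda>f. square_integrable f \<and> piecewise_analytic \<kappa> \<eta> K f"
  define S where "S f = (\<lambda>d. \<lfloor>d / w\<rfloor>) ` discontinuity_points f" for f
  define pt where "pt f x k A = A \<lfloor>x / h\<rfloor> (card {s\<in>S f. s < \<lfloor>x / w\<rfloor>}) k *
        ((x - of_int \<lfloor>x / h\<rfloor> * h) / (\<eta>/2)) ^ k"
    for f x k and A :: "int \<Rightarrow> nat \<Rightarrow> nat \<Rightarrow> real"
  have "\<forall>f. \<exists>A. ?P f \<longrightarrow> (\<forall>j r k. \<bar>A j r k\<bar> \<le> K) \<and> (\<forall>x n. x \<in> {-pi<..<pi} \<longrightarrow> \<lfloor>x / w\<rfloor> \<notin> S f \<longrightarrow>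
      \<bar>f x - (\<Sum>k<n. pt f x k A)\<bar> \<le> 2 * K * (1/2) ^ n)"
    using run_approximation[OF _ pos(1,2) w] unfolding S_def pt_def h_def by blast
  then obtain A where "\<forall>f. ?P f \<longrightarrow> (\<forall>j r k. \<bar>A f j r k\<bar> \<le> K) \<and>
     (\<forall>x n. x \<in> {-pi<..<pi} \<longrightarrow> \<lfloor>x / w\<rfloor> \<notin> S f \<longrightarrow>
      \<bar>f x - (\<Sum>k<n. pt f x k (A f))\<bar> \<le> 2 * K * (1/2) ^ n)"
    by (rule choice[THEN exE])
  then have A_le: "\<And>f j r k. ?P f \<Longrightarrow> \<bar>A f j r k\<bar> \<le> K"
    and A: "\<And>f x n. ?P f \<Longrightarrow> x \<in> {-pi<..<pi} \<Longrightarrow> \<lfloor>x / w\<rfloor> \<notin> S f \<Longrightarrow>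
      \<bar>f x - (\<Sum>k<n. pt f x k (A f))\<bar> \<le> 2 * K * (1/2) ^ n"
    by blast+
  let ?I = "{\<lfloor>-(4/w)\<rfloor>..\<lfloor>4/w\<rfloor>}"
  let ?U = "J \<times> {..\<kappa>} \<times> {..<n}"
  let ?V = "{\<lfloor>-(K/\<delta>)\<rfloor>..\<lfloor>K/\<delta>\<rfloor>}"
  let ?TS = "{S. S \<subseteq> ?I \<and> card S \<le> \<kappa>}"
  let ?T = "?TS \<times> (?U \<rightarrow>\<^sub>E ?V)"
  \<comment> \<open>A function is coded by the set of grid cells of width \<open>w\<close> that its discontinuities hit, together
    with the quantised Taylor coefficients on each run: the runs are the points of one cell of width
    \<open>h\<close> having the same number of hit cells to their left, so equal codes have equal runs.\<close>
  define code where "code f = (S f, restrict (\<lambda>(j, r, k). \<lfloor>A f j r k / \<delta>\<rfloor>) ?U)" for f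
  have cell_range: "\<lfloor>x / v\<rfloor> \<in> {\<lfloor>-(4/v)\<rfloor>..\<lfloor>4/v\<rfloor>}" if "x \<in> {-pi..pi}" "v > 0" for x v :: real
  proof -
    have "-4 \<le> x" "x \<le> 4"
      using that pi_less_4 by auto
    then have "-(4/v) \<le> x / v" "x / v \<le> 4 / v"
      using that(2) by (simp_all add: field_simps)
    then show ?thesis
      unfolding atLeastAtMost_iff by (intro conjI floor_mono)
  qed
  have fin_S: "finite (S f)" and card_S: "card (S f) \<le> \<kappa>" if "?P f" for f
    using that card_image_le[of "discontinuity_points f" "\<lambda>d. \<lfloor>d / w\<rfloor>"]
    by (auto simp: S_def piecewise_analytic_def)
  have fin_T: "finite ?T"
    by (auto intro!: finite_PiE simp: J_def)
  obtain C where C: "finite C" "card C \<le> card ?T"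
    "{l2_class f | f. ?P f} \<subseteq> (\<Union>c\<in>C. ball c \<epsilon>)"
  proof (rule finite_code_cover[where T = ?T and P = ?P and code = code and cls = l2_class and \<epsilon> = \<epsilon>])
    show "finite ?T" by (rule fin_T)
  next
    fix f assume f: "?P f"
    have "S f \<subseteq> ?I"
      using cell_range[OF _ w] by (auto simp: S_def discontinuity_points_def simp del: atLeastAtMost_iff)
    moreover have "\<lfloor>A f j r k / \<delta>\<rfloor> \<in> ?V" for j r k
    proof -
      have "-K \<le> A f j r k" "A f j r k \<le> K"
        using A_le[OF f, of j r k] by auto
      then have "-(K/\<delta>) \<le> A f j r k / \<delta>" "A f j r k / \<delta> \<le> K/\<delta>"
        using \<delta> by (simp_all add: field_simps)
      then show ?thesis
        unfolding atLeastAtMost_iff by (intro conjI floor_mono)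
    qed
    ultimately show "code f \<in> ?T"
      using card_S[OF f] by (auto simp: code_def simp del: atLeastAtMost_iff)
  next
    fix f g assume f: "?P f" and g: "?P g" and eq: "code f = code g"
    have S_eq: "S g = S f"
      using eq by (simp add: code_def)
    \<comment> \<open>Since the hit cells agree, \<open>x\<close> has the same cell and rank for
      both functions, so the compared coefficients have equal codes. Their differences, at most
      \<delta> each, are weighted by powers of 1/2.\<close>
    have close: "\<bar>f x - g x\<bar> \<le> 3 * \<delta>" if x: "x \<in> {-pi<..<pi}" "\<lfloor>x / w\<rfloor> \<notin> S f" for x
    proof -
      let ?j = "\<lfloor>x / h\<rfloor>" and ?r = "card {s\<in>S f. s < \<lfloor>x / w\<rfloor>}"
      define t where "t = (x - of_int ?j * h) / (\<eta>/2)"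
      have t: "\<bar>t\<bar> \<le> 1/2"
        using floor_divide_lower[OF h, of x] floor_divide_upper[OF h, of x] pos(1)
        by (simp add: t_def abs_le_iff field_simps) (simp add: h_def algebra_simps)
      have j: "?j \<in> J"
        using cell_range[OF _ h, of x] x by (auto simp: J_def h_def)
      have r: "?r \<le> \<kappa>"
        using card_S[OF f] card_mono[OF fin_S[OF f], of "{s\<in>S f. s < \<lfloor>x / w\<rfloor>}"] by auto
      have "\<bar>A f ?j ?r k - A g ?j ?r k\<bar> \<le> \<delta>" if "k < n" for k
      proof (rule floor_eq_imp_close[OF _ \<delta>])
        have "snd (code f) (?j, ?r, k) = snd (code g) (?j, ?r, k)"
          using eq by simp
        then show "\<lfloor>A f ?j ?r k / \<delta>\<rfloor> = \<lfloor>A g ?j ?r k / \<delta>\<rfloor>"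
          using j r that by (simp add: code_def)
      qed
      then have "\<bar>pt f x k (A f) - pt g x k (A g)\<bar> \<le> \<delta> * (1/2) ^ k" if "k < n" for k
        using that t \<delta> unfolding pt_def S_eq t_def[symmetric] left_diff_distrib[symmetric]
          abs_mult power_abs by (intro mult_mono power_mono) auto
      then have "(\<Sum>k<n. \<bar>pt f x k (A f) - pt g x k (A g)\<bar>) \<le> (\<Sum>k<n. \<delta> * (1/2) ^ k)"
        by (intro sum_mono) auto
      also have "\<dots> = \<delta> * (\<Sum>k<n. (1/2) ^ k)"
        by (simp add: sum_distrib_left)
      also have "\<dots> \<le> \<delta> * 2"
        using \<delta> by (intro mult_left_mono) (auto simp: sum_gp_strict)
      finally have "(\<Sum>k<n. \<bar>pt f x k (A f) - pt g x k (A g)\<bar>) \<le> 2 * \<delta>"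
        by simp
      then have "\<bar>(\<Sum>k<n. pt f x k (A f)) - (\<Sum>k<n. pt g x k (A g))\<bar> \<le> 2 * \<delta>"
        unfolding sum_subtractf[symmetric] by (rule order_trans[OF sum_abs])
      moreover have "2 * K * (1/2) ^ n + 2 * K * (1/2) ^ n \<le> \<delta>"
        using n by (simp add: \<delta>_def)
      ultimately show ?thesis
        using A[OF f x, of n] A[OF g x(1), of n] x(2) S_eq by (simp add: abs_le_iff)
    qed
    have "(dist (l2_class f) (l2_class g))\<^sup>2 \<le> 2 * pi * (3 * \<delta>)\<^sup>2 + (2 * K)\<^sup>2 * (real \<kappa> * w)"
    proof (rule l2_dist_le_off_cells[OF _ _ fin_S[OF f] card_S[OF f] w])
      show "finite (discontinuity_points f \<union> discontinuity_points g)"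
        using f g by (auto simp: piecewise_analytic_def)
      show "\<bar>f x - g x\<bar> \<le> 2 * K"
        if "x \<in> {-pi<..<pi} - (discontinuity_points f \<union> discontinuity_points g)" for x
        using bounded_off_discontinuities[of \<kappa> \<eta> K f x] bounded_off_discontinuities[of \<kappa> \<eta> K g x]
          f g pos that by auto
    qed (use f g close in auto)
    moreover have "2 * pi * (3 * \<delta>)\<^sup>2 \<le> 2 * 4 * (3 * \<delta>)\<^sup>2"
      using pi_less_4 by (intro mult_right_mono) auto
    moreover have "2 * 4 * (3 * \<delta>)\<^sup>2 < \<epsilon>\<^sup>2 / 2"
      using pos by (simp add: \<delta>_def power2_eq_square)
    moreover have "(2 * K)\<^sup>2 * (real \<kappa> * w) \<le> \<epsilon>\<^sup>2 / 2"
    proof -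
      have "(2 * K)\<^sup>2 * (real \<kappa> * w) = \<epsilon>\<^sup>2 / 2 * (real \<kappa> / (real \<kappa> + 1))"
      proof -
        have "4 * K\<^sup>2 * (a * (b / (8 * K\<^sup>2 * c))) = b / 2 * (a / c)" if "c > 0" for a b c :: real
          using that pos by (simp add: field_simps)
        from this[of "real \<kappa> + 1"] show ?thesis
          by (simp add: w_def power_mult_distrib)
      qed
      also have "\<dots> \<le> \<epsilon>\<^sup>2 / 2 * 1"
        by (intro mult_left_mono) auto
      finally show ?thesis by simp
    qed
    ultimately have "(dist (l2_class f) (l2_class g))\<^sup>2 < \<epsilon>\<^sup>2"
      by linarith
    then show "dist (l2_class f) (l2_class g) < \<epsilon>"
      using pos(3) by (intro power2_less_imp_less[of _ \<epsilon>]) auto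
  qed
  show ?thesis
  proof
    show "finite C" by (rule C)
    show "PA \<kappa> \<eta> K \<subseteq> (\<Union>c\<in>C. ball c \<epsilon>)"
      using C(3) by (simp add: PA_def)
    have "real (card ?TS) \<le> real ((\<kappa> + 1) * (card ?I + 1) ^ \<kappa>)"
      by (intro of_nat_mono card_bounded_subsets_le finite_atLeastAtMost_int)
    also have "\<dots> = (real \<kappa> + 1) * (real (card ?I) + 1) ^ \<kappa>"
      by (simp only: of_nat_mult of_nat_power of_nat_add of_nat_1)
    also have "\<dots> \<le> (real \<kappa> + 1) * (64 * K\<^sup>2 * (real \<kappa> + 1) / \<epsilon>\<^sup>2 + 3) ^ \<kappa>"
    proof (intro mult_left_mono power_mono)
      have "real (card ?I) \<le> 2 * (4/w) + 2"
        using w by (intro card_floor_interval) auto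
      moreover have "2 * (4/w) + 3 = 64 * K\<^sup>2 * (real \<kappa> + 1) / \<epsilon>\<^sup>2 + 3"
        by (simp add: w_def)
      ultimately show "real (card ?I) + 1 \<le> 64 * K\<^sup>2 * (real \<kappa> + 1) / \<epsilon>\<^sup>2 + 3"
        by linarith
    qed auto
    finally have TS: "real (card ?TS) \<le> (real \<kappa> + 1) * (64 * K\<^sup>2 * (real \<kappa> + 1) / \<epsilon>\<^sup>2 + 3) ^ \<kappa>" .
    have fin_J: "finite J"
      by (simp add: J_def)
    have "real (card (?U \<rightarrow>\<^sub>E ?V)) = real (card ?V) ^ (card J * (\<kappa> + 1) * n)"
      using fin_J by (simp add: card_PiE algebra_simps del: card_atLeastAtMost_int)
    also have "\<dots> \<le> (32 * K / \<epsilon> + 2) ^ (card J * (\<kappa> + 1) * n)"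
    proof (rule power_mono)
      have "real (card ?V) \<le> 2 * (K/\<delta>) + 2"
        using pos \<delta> by (intro card_floor_interval) auto
      moreover have "2 * (K/\<delta>) = 32 * K / \<epsilon>"
        by (simp add: \<delta>_def)
      ultimately show "real (card ?V) \<le> 32 * K / \<epsilon> + 2"
        by linarith
    qed auto
    finally have UV: "real (card (?U \<rightarrow>\<^sub>E ?V)) \<le> (32 * K / \<epsilon> + 2) ^ (card J * (\<kappa> + 1) * n)" .
    have "real (card C) \<le> real (card ?TS) * real (card (?U \<rightarrow>\<^sub>E ?V))"
      using C(2) by (simp only: card_cartesian_product flip: of_nat_mult of_nat_le_iff)
    also have "\<dots> \<le> (real \<kappa> + 1) * (64 * K\<^sup>2 * (real \<kappa> + 1) / \<epsilon>\<^sup>2 + 3) ^ \<kappa>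
        * (32 * K / \<epsilon> + 2) ^ (card J * (\<kappa> + 1) * n)"
      using pos by (intro mult_mono TS UV) auto
    finally show "real (card C) \<le> \<dots>" .
  qed
qed

section \<open>Separated cosine sums\<close>

lemma has_integral_cos_int:
  assumes "m \<in> \<int>" "m \<noteq> 0"
  shows "((\<lambda>x. cos (m * x)) has_integral 0) {-pi..pi}"
proof -
  have "((\<lambda>x. cos (m * x)) has_integral (sin (m * pi) / m - sin (m * (-pi)) / m)) {-pi..pi}"
    using assms(2) by (intro fundamental_theorem_of_calculus)
      (auto intro!: derivative_eq_intros simp flip: has_real_derivative_iff_has_vector_derivative)
  moreover have "sin (m * pi) = 0"
    using assms(1) sin_integer_2pi[of "m/2"] by (auto elim!: Ints_cases simp: sin_zero_iff_int2)
  ultimately show ?thesis by simp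
qed

text \<open>The product-to-sum formula leaves cosines of frequencies k - l and k + l. As k and l are
  positive, only k - l can vanish.\<close>

lemma integral_cos_cos:
  fixes k l :: nat
  assumes "0 < k" "0 < l"
  shows "integral\<^sup>L leb_pi (\<lambda>x. cos (k * x) * cos (l * x)) = (if k = l then pi else 0)"
proof -
  have "integral\<^sup>L leb_pi (\<lambda>x. cos (k * x) * cos (l * x)) =
      integral {-pi..pi} (\<lambda>x. cos (k * x) * cos (l * x))"
    by (intro lebesgue_integral_eq_integral continuous_imp_integrable_real continuous_intros) auto
  also have "\<dots> = integral {-pi..pi}
      (\<lambda>x. cos ((real k - real l) * x) / 2 + cos ((real k + real l) * x) / 2)"
    by (simp add: cos_times_cos left_diff_distrib distrib_right add_divide_distrib)
  also have "\<dots> = (if k = l then pi else 0)"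
  proof (rule integral_unique)
    have "((\<lambda>x. cos ((real k - real l) * x)) has_integral (if k = l then 2 * pi else 0)) {-pi..pi}"
      using has_integral_cos_int[of "real k - real l"] has_integral_const_real[of "1::real" "-pi" pi]
      by auto
    moreover have "((\<lambda>x. cos ((real k + real l) * x)) has_integral 0) {-pi..pi}"
      using assms by (intro has_integral_cos_int) auto
    ultimately have "((\<lambda>x. cos ((real k - real l) * x) / 2 + cos ((real k + real l) * x) / 2)
        has_integral (if k = l then 2 * pi else 0) / 2 + 0 / 2) {-pi..pi}"
      by (intro has_integral_add has_integral_divide)
    then show "((\<lambda>x. cos ((real k - real l) * x) / 2 + cos ((real k + real l) * x) / 2)
        has_integral (if k = l then pi else 0)) {-pi..pi}"
      by (cases "k = l") auto
  qed
  finally show ?thesis .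
qed

lemma integral_cosine_sum_squared:
  fixes c :: "nat \<Rightarrow> real"
  shows "integral\<^sup>L leb_pi (\<lambda>x. (\<Sum>k=1..n. c k * cos (k * x))\<^sup>2) = pi * (\<Sum>k=1..n. (c k)\<^sup>2)"
proof -
  have int: "integrable leb_pi (\<lambda>x. c k * cos (k * x) * (c l * cos (l * x)))" for k l :: nat
    by (intro continuous_imp_integrable_real continuous_intros)
  have "integral\<^sup>L leb_pi (\<lambda>x. (\<Sum>k=1..n. c k * cos (k * x))\<^sup>2) =
      (\<Sum>k=1..n. \<Sum>l=1..n. integral\<^sup>L leb_pi (\<lambda>x. c k * cos (k * x) * (c l * cos (l * x))))"
    unfolding power2_eq_square sum_product using int by simp
  also have "\<dots> = (\<Sum>k=1..n. \<Sum>l=1..n. if k = l then c k * c l * pi else 0)"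
  proof (intro sum.cong refl)
    fix k l assume kl: "k \<in> {1..n}" "l \<in> {1..n}"
    have "integral\<^sup>L leb_pi (\<lambda>x. c k * cos (k * x) * (c l * cos (l * x))) =
        c k * c l * integral\<^sup>L leb_pi (\<lambda>x. cos (k * x) * cos (l * x))"
      by (subst integral_mult_right_zero[symmetric]) (simp add: mult_ac)
    then show "integral\<^sup>L leb_pi (\<lambda>x. c k * cos (k * x) * (c l * cos (l * x))) =
        (if k = l then c k * c l * pi else 0)"
      using integral_cos_cos[of k l] kl by simp
  qed
  also have "\<dots> = pi * (\<Sum>k=1..n. (c k)\<^sup>2)"
    by (simp add: sum_distrib_left power2_eq_square mult_ac)
  finally show ?thesis .
qed

definition cosine_sum :: "nat \<Rightarrow> (nat \<Rightarrow> real) \<Rightarrow> real \<Rightarrow> real" where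
  "cosine_sum n c x = (\<Sum>k=1..n. c k * cos (k * x))"

lemma continuous_on_cosine_sum: "continuous_on A (cosine_sum n c)"
  unfolding cosine_sum_def by (intro continuous_intros)

lemma square_integrable_cosine_sum: "square_integrable (cosine_sum n c)"
  unfolding square_integrable_def
proof
  have "integrable leb_pi (cosine_sum n c)"
    by (intro continuous_imp_integrable_real continuous_on_cosine_sum)
  then show "cosine_sum n c \<in> borel_measurable leb_pi"
    by (rule borel_measurable_integrable)
  show "integrable leb_pi (\<lambda>x. (cosine_sum n c x)\<^sup>2)"
    by (intro continuous_imp_integrable_real continuous_intros continuous_on_cosine_sum)
qed

lemma dist_cosine_sum:
  "(dist (l2_class (cosine_sum n c)) (l2_class (cosine_sum n d)))\<^sup>2 = pi * (\<Sum>k=1..n. (c k - d k)\<^sup>2)"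
proof -
  have "cosine_sum n c x - cosine_sum n d x = (\<Sum>k=1..n. (c k - d k) * cos (k * x))"
    for x :: real
    by (simp add: cosine_sum_def sum_subtractf left_diff_distrib)
  then show ?thesis
    by (simp only: dist_l2_class[OF square_integrable_cosine_sum square_integrable_cosine_sum]
        integral_cosine_sum_squared)
qed

text \<open>A cosine sum is entire and has no discontinuities, so the whole interval is its only
  piece. Every point of the neighbourhood has modulus at most pi + \<eta>, and |cos (k z)| is at
  most exp (k |z|).\<close>

lemma cosine_sum_in_PA:
  fixes n :: nat and \<eta> K b :: real
  assumes \<eta>: "\<eta> > 0" and c: "\<And>k. k \<in> {1..n} \<Longrightarrow> \<bar>c k\<bar> \<le> b"
    and K: "real n * (b * exp (n * (pi + \<eta>))) \<le> K"
  shows "l2_class (cosine_sum n c) \<in> PA \<kappa> \<eta> K"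
proof -
  have D: "discontinuity_points (cosine_sum n c) = {}"
    using continuous_on_cosine_sum[of "{-pi..pi}" n c]
    by (auto simp: discontinuity_points_def continuous_on_eq_continuous_within)
  have "extends_bounded \<eta> K (cosine_sum n c) (-pi) pi"
    unfolding extends_bounded_def
  proof (intro exI conjI ballI)
    let ?F = "\<lambda>z. \<Sum>k=1..n. of_real (c k) * cos (of_nat k * z)"
    show "?F holomorphic_on complex_nbhd \<eta> (-pi) pi"
      by (intro holomorphic_intros)
    show "?F (complex_of_real x) = complex_of_real (cosine_sum n c x)" for x
      by (simp add: cosine_sum_def cos_of_real[symmetric])
    fix z assume "z \<in> complex_nbhd \<eta> (-pi) pi"
    then obtain x where x: "x \<in> {-pi..pi}" "dist (complex_of_real x) z < \<eta>"
      by (auto simp: complex_nbhd_def)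
    have "norm z \<le> norm (complex_of_real x) + dist (complex_of_real x) z"
      by (metis dist_norm norm_minus_commute norm_triangle_sub)
    with x have z: "norm z \<le> pi + \<eta>"
      by auto
    have "norm (?F z) \<le> (\<Sum>k=1..n. b * exp (n * (pi + \<eta>)))"
    proof (rule sum_norm_le)
      fix k assume k: "k \<in> {1..n}"
      have "norm (cos (of_nat k * z)) \<le> exp (norm (of_nat k * z))"
        by (rule norm_cos_le)
      also have "\<dots> \<le> exp (n * (pi + \<eta>))"
        using k z by (auto simp: norm_mult intro!: mult_mono)
      finally show "norm (of_real (c k) * cos (of_nat k * z)) \<le> b * exp (n * (pi + \<eta>))"
        using c[OF k] unfolding norm_mult norm_of_real by (intro mult_mono) auto
    qed
    then show "norm (?F z) \<le> K"
      using K by simp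
  qed
  then have "piecewise_analytic \<kappa> \<eta> K (cosine_sum n c)"
    unfolding piecewise_analytic_def D by auto
  then show ?thesis
    unfolding PA_def using square_integrable_cosine_sum by blast
qed

text \<open>
  The cover from \<open>PA_cover\<close> is needed here as well: without any finite cover the covering number
  would be the junk value 0.
\<close>

lemma covering_number_PA_ge:
  fixes n m \<kappa> :: nat and \<eta> K \<epsilon> :: real
  assumes pos: "\<eta> > 0" "K > 0" "\<epsilon> > 0"
    and K: "real n * (2 * \<epsilon> * real m * exp (n * (pi + \<eta>))) \<le> K"
  shows "m ^ n \<le> covering_number \<epsilon> (PA \<kappa> \<eta> K)"
proof -
  let ?T = "{1..n} \<rightarrow>\<^sub>E {..<m}"
  \<comment> \<open>With spacing 2 \<epsilon>, a single differing coordinate already separates two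
    sums by 2 \<epsilon>, because each cosine has squared norm pi > 1.\<close>
  let ?x = "\<lambda>t. l2_class (cosine_sum n (\<lambda>k. 2 * \<epsilon> * real (t k)))"
  obtain N :: nat where "64 * K / \<epsilon> < 2 ^ N"
    using real_arch_pow[of 2 "64 * K / \<epsilon>"] by auto
  then have "64 * K * (1/2) ^ N \<le> \<epsilon>"
    using pos by (simp add: field_simps power_one_over)
  then obtain C where "finite C" "PA \<kappa> \<eta> K \<subseteq> (\<Union>c\<in>C. ball c \<epsilon>)"
    using PA_cover pos by metis
  then have "card ?T \<le> covering_number \<epsilon> (PA \<kappa> \<eta> K)"
  proof (rule separated_le_covering_number[where x = ?x])
    fix t assume t: "t \<in> ?T"
    show "?x t \<in> PA \<kappa> \<eta> K"
    proof (rule cosine_sum_in_PA[OF pos(1) _ K])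
      fix k assume "k \<in> {1..n}"
      then have "t k < m" using t by auto
      then show "\<bar>2 * \<epsilon> * real (t k)\<bar> \<le> 2 * \<epsilon> * real m"
        using pos by simp
    qed
  next
    fix s t assume st: "s \<in> ?T" "t \<in> ?T" "s \<noteq> t"
    then obtain k where k: "k \<in> {1..n}" "s k \<noteq> t k"
      using PiE_ext by blast
    have "1 \<le> \<bar>int (s k) - int (t k)\<bar>"
      using k by simp
    then have "1 \<le> \<bar>real (s k) - real (t k)\<bar>"
      by (metis (mono_tags) of_int_1_le_iff of_int_abs of_int_diff of_int_of_nat_eq)
    then have "1 \<le> (real (s k) - real (t k))\<^sup>2"
      using power_mono[of 1 "\<bar>real (s k) - real (t k)\<bar>" 2] by simp
    then have "(2 * \<epsilon>)\<^sup>2 * 1 \<le> (2 * \<epsilon>)\<^sup>2 * (real (s k) - real (t k))\<^sup>2"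
      by (intro mult_left_mono) auto
    also have "\<dots> = (2 * \<epsilon> * real (s k) - 2 * \<epsilon> * real (t k))\<^sup>2"
      by (simp add: power_mult_distrib flip: right_diff_distrib)
    also have "\<dots> \<le> (\<Sum>k=1..n. (2 * \<epsilon> * real (s k) - 2 * \<epsilon> * real (t k))\<^sup>2)"
      using k by (intro member_le_sum) auto
    also have "\<dots> \<le> pi * (\<Sum>k=1..n. (2 * \<epsilon> * real (s k) - 2 * \<epsilon> * real (t k))\<^sup>2)"
      using pi_gt3 by (intro mult_right_mono[of 1 pi, simplified] sum_nonneg) auto
    also have "\<dots> = (dist (?x s) (?x t))\<^sup>2"
      by (rule dist_cosine_sum[symmetric])
    finally have "(2 * \<epsilon>)\<^sup>2 \<le> (dist (?x s) (?x t))\<^sup>2"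
      unfolding mult_1_right .
    then show "2 * \<epsilon> \<le> dist (?x s) (?x t)"
      by (rule power2_le_imp_le) (rule zero_le_dist)
  qed
  then show ?thesis
    by (simp add: card_PiE)
qed

section \<open>Explicit entropy bounds and their asymptotics\<close>

text \<open>The exponent -1/4 leaves room: n at most ln (1/\<epsilon>) / (4 (pi + \<eta>)) keeps the
  exponential growth below \<epsilon>^(-1/4), and m is at most \<epsilon>^(-1/4) as well. The cosine
  sums are then bounded by a multiple of \<epsilon>^(1/2) ln (1/\<epsilon>), which tends to 0 and so
  drops below K. The subtracted ones absorb the rounding of n and m.\<close>

lemma entropy_PA_ge:
  fixes \<kappa> :: nat and \<eta> K :: real
  assumes pos: "\<eta> > 0" "K > 0"
  shows "\<forall>\<^sub>F \<epsilon> in at_right 0.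
    (ln (1/\<epsilon>) / (4 * (pi + \<eta>)) - 1) * log 2 (\<epsilon> powr (-1/4) - 1) \<le> kolmogorov_entropy \<epsilon> (PA \<kappa> \<eta> K)"
proof -
  define a where "a = pi + \<eta>"
  have a: "a > 0"
    using pos pi_gt_zero by (simp add: a_def add_pos_pos)
  have ev: "\<forall>\<^sub>F \<epsilon>::real in at_right 0. ln (1/\<epsilon>) / (4*a) * (2 * \<epsilon> * \<epsilon> powr (-1/4) * \<epsilon> powr (-1/4)) < K"
    using a pos(2) by real_asymp
  \<comment> \<open>The threshold 2 makes the logarithm of \<open>\<epsilon> powr (-1/4) - 1\<close>
    positive and forces m > 1 after rounding.\<close>
  have ev1: "\<forall>\<^sub>F \<epsilon>::real in at_right 0. 0 < \<epsilon> \<and> \<epsilon> powr (-1/4) > 2 \<and> ln (1/\<epsilon>) / (4*a) > 1"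
    using a by (intro eventually_conj; real_asymp)
  show ?thesis
    using ev ev1
  proof eventually_elim
    fix \<epsilon> :: real
    assume 1: "ln (1/\<epsilon>) / (4*a) * (2 * \<epsilon> * \<epsilon> powr (-1/4) * \<epsilon> powr (-1/4)) < K"
      and 2: "0 < \<epsilon> \<and> \<epsilon> powr (-1/4) > 2 \<and> ln (1/\<epsilon>) / (4*a) > 1"
    define L where "L = ln (1/\<epsilon>) / (4*a)"
    define n where "n = nat \<lfloor>L\<rfloor>"
    define m where "m = nat \<lfloor>\<epsilon> powr (-1/4)\<rfloor>"
    have n: "real n \<le> L" "L - 1 \<le> real n"
      using 2 unfolding n_def L_def by linarith+
    have m: "real m \<le> \<epsilon> powr (-1/4)" "\<epsilon> powr (-1/4) - 1 \<le> real m"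
      using 2 unfolding m_def by linarith+
    have "exp (n * a) \<le> exp (L * a)"
      using n a by simp
    also have "L * a = -1/4 * ln \<epsilon>"
      using a 2 by (simp add: L_def ln_div)
    also have "exp \<dots> = \<epsilon> powr (-1/4)"
      using 2 by (simp add: powr_def)
    finally have e: "exp (n * a) \<le> \<epsilon> powr (-1/4)" .
    have "real n * (2 * \<epsilon> * real m * exp (n * a)) \<le> L * (2 * \<epsilon> * \<epsilon> powr (-1/4) * \<epsilon> powr (-1/4))"
      using n m e 2 by (intro mult_mono) auto
    then have "real n * (2 * \<epsilon> * real m * exp (n * (pi + \<eta>))) \<le> K"
      using 1 by (simp add: L_def a_def)
    then have cov: "m ^ n \<le> covering_number \<epsilon> (PA \<kappa> \<eta> K)"
      using 2 pos by (intro covering_number_PA_ge) auto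
    have m1: "1 < real m"
      using m 2 by linarith
    have "(L - 1) * log 2 (\<epsilon> powr (-1/4) - 1) \<le> real n * log 2 (real m)"
      using n m 2 m1 by (intro mult_mono) (auto simp: L_def)
    also have "\<dots> = log 2 (real (m ^ n))"
      using m1 by (simp add: log_nat_power)
    also have "\<dots> \<le> kolmogorov_entropy \<epsilon> (PA \<kappa> \<eta> K)"
      unfolding kolmogorov_entropy_def
    proof (rule log_mono)
      show "0 < real (m ^ n)"
        using m1 by simp
      show "real (m ^ n) \<le> real (covering_number \<epsilon> (PA \<kappa> \<eta> K))"
        using cov by (rule of_nat_mono)
    qed simp
    finally show "(ln (1/\<epsilon>) / (4 * (pi + \<eta>)) - 1) * log 2 (\<epsilon> powr (-1/4) - 1) \<le>
        kolmogorov_entropy \<epsilon> (PA \<kappa> \<eta> K)"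
      by (simp add: L_def a_def)
  qed
qed

text \<open>Here \<open>B\<close> counts the pairs of coarse cell and rank and does not depend on
  \<epsilon>. The number n of Taylor coefficients is the least that meets the truncation condition
  of \<open>PA_cover\<close>, hence of order log (1/\<epsilon>); each coefficient costs O(log
  (1/\<epsilon>)) bits.\<close>

lemma entropy_PA_le:
  fixes \<kappa> :: nat and \<eta> K :: real
  assumes pos: "\<eta> > 0" "K > 0"
  obtains B :: nat where "\<forall>\<^sub>F \<epsilon> in at_right 0. kolmogorov_entropy \<epsilon> (PA \<kappa> \<eta> K) \<le>
    log 2 (real \<kappa> + 1) + real \<kappa> * log 2 (64 * K\<^sup>2 * (real \<kappa> + 1) / \<epsilon>\<^sup>2 + 3) +
    real B * (log 2 (64 * K / \<epsilon>) + 1) * log 2 (32 * K / \<epsilon> + 2)"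
proof -
  define J where "J = {\<lfloor>-(4 / (\<eta>/4))\<rfloor>..\<lfloor>4 / (\<eta>/4)\<rfloor>}"
  define B where "B = card J * (\<kappa> + 1)"
  have ev: "\<forall>\<^sub>F \<epsilon>::real in at_right 0. 0 < \<epsilon> \<and> 64 * K / \<epsilon> > 1"
    using pos by (intro eventually_conj; real_asymp)
  have "\<forall>\<^sub>F \<epsilon> in at_right 0. kolmogorov_entropy \<epsilon> (PA \<kappa> \<eta> K) \<le>
    log 2 (real \<kappa> + 1) + real \<kappa> * log 2 (64 * K\<^sup>2 * (real \<kappa> + 1) / \<epsilon>\<^sup>2 + 3) +
    real B * (log 2 (64 * K / \<epsilon>) + 1) * log 2 (32 * K / \<epsilon> + 2)"
    using ev
  proof eventually_elim
    fix \<epsilon> :: real assume "0 < \<epsilon> \<and> 64 * K / \<epsilon> > 1"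
    then have \<epsilon>: "0 < \<epsilon>" "64 * K / \<epsilon> > 1" by auto
    define n where "n = nat \<lceil>log 2 (64 * K / \<epsilon>)\<rceil>"
    have "0 < log 2 (64 * K / \<epsilon>)"
      using \<epsilon> by simp
    then have n: "log 2 (64 * K / \<epsilon>) \<le> real n" "real n \<le> log 2 (64 * K / \<epsilon>) + 1"
      unfolding n_def by linarith+
    have "64 * K / \<epsilon> \<le> 2 ^ n"
      using n(1) \<epsilon> by (simp add: log_le_iff powr_realpow)
    then have "64 * K * (1/2) ^ n \<le> \<epsilon>"
      using \<epsilon> by (simp add: field_simps power_one_over)
    then obtain C where C: "finite C" "PA \<kappa> \<eta> K \<subseteq> (\<Union>c\<in>C. ball c \<epsilon>)"
      "real (card C) \<le> (real \<kappa> + 1) * (64 * K\<^sup>2 * (real \<kappa> + 1) / \<epsilon>\<^sup>2 + 3) ^ \<kappa>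
        * (32 * K / \<epsilon> + 2) ^ (B * n)"
      using PA_cover[OF pos \<epsilon>(1)] unfolding B_def J_def by metis
    have p: "64 * K\<^sup>2 * (real \<kappa> + 1) / \<epsilon>\<^sup>2 + 3 > 0" "32 * K / \<epsilon> + 2 > 1"
      using pos \<epsilon> by (auto intro!: add_nonneg_pos add_nonneg_pos[of _ 1, simplified] simp: add_pos_pos)
    \<comment> \<open>Monotonicity of the logarithm needs a positive argument. The lower bound with
      n = m = 0 provides it, since 0^0 = 1.\<close>
    have "1 \<le> covering_number \<epsilon> (PA \<kappa> \<eta> K)"
      using covering_number_PA_ge[of \<eta> K \<epsilon> 0 0 \<kappa>] pos \<epsilon> by simp
    then have "kolmogorov_entropy \<epsilon> (PA \<kappa> \<eta> K) \<le>
        log 2 ((real \<kappa> + 1) * (64 * K\<^sup>2 * (real \<kappa> + 1) / \<epsilon>\<^sup>2 + 3) ^ \<kappa>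
        * (32 * K / \<epsilon> + 2) ^ (B * n))"
      unfolding kolmogorov_entropy_def using covering_number_le[OF C(1,2)] C(3)
      by (intro log_mono) auto
    also have "\<dots> = log 2 (real \<kappa> + 1) + real \<kappa> * log 2 (64 * K\<^sup>2 * (real \<kappa> + 1) / \<epsilon>\<^sup>2 + 3) +
        real B * real n * log 2 (32 * K / \<epsilon> + 2)"
      using p by (simp add: log_mult log_nat_power)
    also have "\<dots> \<le> log 2 (real \<kappa> + 1) + real \<kappa> * log 2 (64 * K\<^sup>2 * (real \<kappa> + 1) / \<epsilon>\<^sup>2 + 3) +
        real B * (log 2 (64 * K / \<epsilon>) + 1) * log 2 (32 * K / \<epsilon> + 2)"
      using n p by (intro add_left_mono mult_right_mono mult_left_mono) auto
    finally show "kolmogorov_entropy \<epsilon> (PA \<kappa> \<eta> K) \<le> \<dots>" .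
  qed
  then show ?thesis by (rule that)
qed

theorem theorem4p3:
  fixes \<kappa> :: nat and \<eta> K :: real
  assumes "\<eta> > 0" and "K > 0"
  shows "(\<lambda>\<epsilon>. kolmogorov_entropy \<epsilon> (PA \<kappa> \<eta> K)) \<in> \<Theta>[at_right 0](\<lambda>\<epsilon>. (ln (1 / \<epsilon>))\<^sup>2)"
proof (rule bigthetaI)
  let ?H = "\<lambda>\<epsilon>. kolmogorov_entropy \<epsilon> (PA \<kappa> \<eta> K)"
  define a where "a = pi + \<eta>"
  have a: "a > 0"
    using assms pi_gt_zero by (simp add: a_def add_pos_pos)
  let ?l = "\<lambda>\<epsilon>::real. (ln (1/\<epsilon>) / (4 * a) - 1) * log 2 (\<epsilon> powr (-1/4) - 1)"
  have lower: "\<forall>\<^sub>F \<epsilon> in at_right 0. ?l \<epsilon> \<le> ?H \<epsilon>"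
    using entropy_PA_ge[OF assms] by (simp add: a_def)
  \<comment> \<open>Landau comparisons involve absolute values; nonnegativity of \<open>?l\<close>,
    and hence of the entropy and its upper bound, reduces them to plain inequalities.\<close>
  have l_pos: "\<forall>\<^sub>F \<epsilon> in at_right 0. 0 \<le> ?l \<epsilon>"
    using a by real_asymp
  obtain B :: nat where upper: "\<forall>\<^sub>F \<epsilon> in at_right 0. ?H \<epsilon> \<le>
    log 2 (real \<kappa> + 1) + real \<kappa> * log 2 (64 * K\<^sup>2 * (real \<kappa> + 1) / \<epsilon>\<^sup>2 + 3) +
    real B * (log 2 (64 * K / \<epsilon>) + 1) * log 2 (32 * K / \<epsilon> + 2)" (is "\<forall>\<^sub>F \<epsilon> in _. _ \<le> ?u \<epsilon>")
    using entropy_PA_le[OF assms] by blast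
  have "?H \<in> O[at_right 0](?u)"
    by (rule landau_o.big_mono) (use lower l_pos upper in eventually_elim, simp)
  also have "?u \<in> O[at_right 0](\<lambda>\<epsilon>. (ln (1 / \<epsilon>))\<^sup>2)"
  \<comment> \<open>The summands are O(1), O(log (1/\<epsilon>)) and O(log (1/\<epsilon>)^2); only
    the coefficient count can reach the full order.\<close>
  proof (intro sum_in_bigo)
    define c where "c = 64 * K\<^sup>2 * (real \<kappa> + 1)"
    have c: "c > 0"
      using assms by (simp add: c_def)
    show "(\<lambda>\<epsilon>. log 2 (real \<kappa> + 1)) \<in> O[at_right 0](\<lambda>\<epsilon>. (ln (1 / \<epsilon>))\<^sup>2)"
      by real_asymp
    have "(\<lambda>\<epsilon>. log 2 (c / \<epsilon>\<^sup>2 + 3)) \<in> O[at_right 0](\<lambda>\<epsilon>. (ln (1 / \<epsilon>))\<^sup>2)"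
      using c by real_asymp
    then show "(\<lambda>\<epsilon>. real \<kappa> * log 2 (64 * K\<^sup>2 * (real \<kappa> + 1) / \<epsilon>\<^sup>2 + 3)) \<in> O[at_right 0](\<lambda>\<epsilon>. (ln (1 / \<epsilon>))\<^sup>2)"
      by (simp add: c_def)
    have "(\<lambda>\<epsilon>. (log 2 (64 * K / \<epsilon>) + 1) * log 2 (32 * K / \<epsilon> + 2)) \<in> O[at_right 0](\<lambda>\<epsilon>. (ln (1 / \<epsilon>))\<^sup>2)"
      using assms by real_asymp
    then show "(\<lambda>\<epsilon>. real B * (log 2 (64 * K / \<epsilon>) + 1) * log 2 (32 * K / \<epsilon> + 2)) \<in> O[at_right 0](\<lambda>\<epsilon>. (ln (1 / \<epsilon>))\<^sup>2)"
      by (simp add: mult.assoc)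
  qed
  finally show "?H \<in> O[at_right 0](\<lambda>\<epsilon>. (ln (1 / \<epsilon>))\<^sup>2)" .
  \<comment> \<open>Both factors of \<open>?l\<close> are asymptotic to positive multiples of ln
    (1/\<epsilon>).\<close>
  have "(\<lambda>\<epsilon>. (ln (1 / \<epsilon>))\<^sup>2) \<in> O[at_right 0](?l)"
    using a by real_asymp
  also have "?l \<in> O[at_right 0](?H)"
    by (rule landau_o.big_mono) (use lower l_pos in eventually_elim, simp)
  finally show "?H \<in> \<Omega>[at_right 0](\<lambda>\<epsilon>. (ln (1 / \<epsilon>))\<^sup>2)"
    by (simp add: bigomega_iff_bigo)
qed

end
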